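(* Let $s$ and $t$ be positive integers. For every $n\ge 0$, the number of partitions of $n$ which are simultaneously $s$-regular and $t$-distinct equals the number of partitions of $n$ which are simultaneously $t$-regular and $s$-distinct.
   Context: A partition of $n$ is a nonincreasing finite sequence of positive integers (parts) with sum $n$. A partition is $m$-regular if no part is divisible by $m$, and $m$-distinct if every part size appears fewer than $m$ times. *)

theory Defs
  imports Main
begin

definition partitions :: "nat \<Rightarrow> nat list set" where
  "partitions n = {ps. sorted_wrt (\<ge>) ps \<and> (\<forall>p\<in>set ps. 0 < p) \<and> sum_list ps = n}"

definition regular :: "nat \<Rightarrow> nat list \<Rightarrow> bool" where
  "regular m ps \<longleftrightarrow> (\<forall>p\<in>set ps. \<not> m dvd p)"

definition distinct_parts :: "nat \<Rightarrow> nat list \<Rightarrow> bool" where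
  "distinct_parts m ps \<longleftrightarrow> (\<forall>p\<in>set ps. count_list ps p < m)"

(* Finiteness makes card on subsets of partitions n the genuine number of elements. *)
lemma finite_partitions: "finite (partitions n)"
proof (rule finite_subset)
  have len: "length ps \<le> sum_list ps" if "\<forall>p\<in>set ps. 0 < p" for ps :: "nat list"
    using that by (induction ps) auto
  show "partitions n \<subseteq> {ps. set ps \<subseteq> {..n} \<and> length ps \<le> n}"
    unfolding partitions_def using len member_le_sum_list by fastforce
  show "finite {ps. set ps \<subseteq> {..n} \<and> length ps \<le> n}"
    by (rule finite_lists_length_le) simp
qed

end

(* Write P(k) for the product of 1 - X^(k i) over all i > 0. The generating function of the
   s-regular t-distinct partitions is the product of (1 - X^(t i)) / (1 - X^i) over the i not
   divisible by s, that is P(s) P(t) / (P(1) P(s t)), which is symmetric in s and t. Infinite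
   products are avoided by truncating them and calculating modulo X^(n+1). *)

theory Submission
  imports Defs "HOL-Library.FuncSet" "HOL-Library.Multiset"
    "HOL-Computational_Algebra.Formal_Power_Series"
begin

unbundle fps_syntax

definition nonmultiples :: "nat \<Rightarrow> nat \<Rightarrow> nat set" where
  "nonmultiples s N = {i \<in> {1..N}. \<not> s dvd i}"

lemma finite_nonmultiples [simp]: "finite (nonmultiples s N)"
  by (simp add: nonmultiples_def)

lemma set_regular_partition_subset:
  assumes "ps \<in> partitions n" and "regular s ps" and "n \<le> N"
  shows "set ps \<subseteq> nonmultiples s N"
proof
  fix p assume p: "p \<in> set ps"
  then have "p \<le> sum_list ps" by (rule member_le_sum_list) simp
  with assms p show "p \<in> nonmultiples s N"
    by (auto simp: partitions_def regular_def nonmultiples_def Suc_le_eq)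
qed

text \<open>A partition is determined by its multiplicities. Parts are at most
  \<open>n \<le> N\<close>, so \<open>s\<close>-regularity confines them to the index set and
  \<open>t\<close>-distinctness makes each multiplicity one of the \<open>t\<close> values below
  \<open>t\<close>. Restricting gives one canonical function per partition, as \<open>PiE\<close>
  requires.\<close>

lemma bij_betw_multiplicities:
  assumes "0 < t" and "n \<le> N"
  shows "bij_betw (\<lambda>ps. restrict (count_list ps) (nonmultiples s N))
    {ps \<in> partitions n. regular s ps \<and> distinct_parts t ps}
    {c \<in> nonmultiples s N \<rightarrow>\<^sub>E {..<t}. (\<Sum>i\<in>nonmultiples s N. i * c i) = n}"
    (is "bij_betw ?f ?A ?B")
proof (rule bij_betw_imageI)
  let ?I = "nonmultiples s N"
  have sub: "set ps \<subseteq> ?I" if "ps \<in> ?A" for ps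
    using that set_regular_partition_subset \<open>n \<le> N\<close> by blast
  show "inj_on ?f ?A"
  proof (rule inj_onI)
    fix ps qs assume ps: "ps \<in> ?A" and qs: "qs \<in> ?A" and eq: "?f ps = ?f qs"
    have "count_list ps i = count_list qs i" for i
    proof (cases "i \<in> ?I")
      case True
      with fun_cong[OF eq, of i] show ?thesis by simp
    next
      case False
      with sub[OF ps] sub[OF qs] have "i \<notin> set ps" "i \<notin> set qs" by auto
      then show ?thesis by simp
    qed
    \<comment> \<open>Partitions are nonincreasing, so their reversals are sorted, and a sorted list
      is determined by its multiset.\<close>
    then have "mset (rev ps) = mset (rev qs)" by (simp add: multiset_eq_iff count_mset)
    moreover have "sorted (rev ps)" "sorted (rev qs)"
      using ps qs by (simp_all add: partitions_def sorted_wrt_rev)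
    ultimately have "rev ps = rev qs" by (metis properties_for_sort)
    then show "ps = qs" by simp
  qed
  show "?f ` ?A = ?B"
  proof
    show "?f ` ?A \<subseteq> ?B"
    proof clarify
      fix ps assume ps: "ps \<in> partitions n" "regular s ps" "distinct_parts t ps"
      \<comment> \<open>Only sizes that occur are bounded by \<open>distinct_parts\<close>; an
        absent size has count 0, which is below \<open>t\<close> because \<open>t\<close> is
        positive.\<close>
      have "count_list ps i < t" for i
        using ps(3) \<open>0 < t\<close> by (cases "i \<in> set ps") (auto simp: distinct_parts_def)
      moreover have "(\<Sum>i\<in>?I. count_list ps i * i) = n"
        using sum_list_map_eq_sum_count2[of ps ?I "\<lambda>i. i"] sub[of ps] ps
        by (simp add: partitions_def)
      ultimately show "?f ps \<in> ?I \<rightarrow>\<^sub>E {..<t} \<and> (\<Sum>i\<in>?I. i * ?f ps i) = n"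
        by (auto simp: mult.commute)
    qed
    show "?B \<subseteq> ?f ` ?A"
    proof
      fix c assume c: "c \<in> ?B"
      define M where "M = (\<Sum>i\<in>?I. replicate_mset (c i) i)"
      define ps where "ps = rev (sorted_list_of_multiset M)"
      have mset: "mset ps = M" by (simp add: ps_def)
      have count: "count_list ps i = (if i \<in> ?I then c i else 0)" for i
        unfolding count_mset[symmetric] mset M_def by (simp add: count_sum)
      have set: "set ps \<subseteq> ?I"
        using count by (metis count_list_0_iff subsetI)
      have "sum_list ps = (\<Sum>i\<in>?I. count_list ps i * i)"
        using sum_list_map_eq_sum_count2[of ps ?I "\<lambda>i. i"] set by simp
      also have "\<dots> = n" using c by (simp add: count mult.commute)
      finally have "sum_list ps = n" .
      moreover have "sorted_wrt (\<ge>) ps" by (simp add: ps_def sorted_wrt_rev)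
      ultimately have "ps \<in> ?A"
        using set c
        by (auto simp: partitions_def regular_def distinct_parts_def count nonmultiples_def)
      moreover have "?f ps = c" using c by (auto simp: count PiE_def extensional_def)
      ultimately show "c \<in> ?f ` ?A" by blast
    qed
  qed
qed

text \<open>Coefficients are taken in a field so that \<open>mod\<close> is available on power
  series.\<close>

definition regular_distinct_fps :: "nat \<Rightarrow> nat \<Rightarrow> nat \<Rightarrow> rat fps" where
  "regular_distinct_fps s t N = (\<Prod>i\<in>nonmultiples s N. \<Sum>j<t. (fps_X ^ i) ^ j)"

text \<open>Expanding the product picks an exponent \<open>c i < t\<close> for every
  \<open>i\<close>, contributing a monomial of degree the sum of \<open>i * c i\<close>. Hence the
  coefficient of X^n counts the admissible multiplicity functions of weight
  \<open>n\<close>.\<close>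

lemma regular_distinct_fps_nth:
  assumes "0 < t" and "n \<le> N"
  shows "regular_distinct_fps s t N $ n =
    of_nat (card {ps \<in> partitions n. regular s ps \<and> distinct_parts t ps})"
proof -
  let ?I = "nonmultiples s N"
  have "regular_distinct_fps s t N = (\<Sum>c\<in>?I \<rightarrow>\<^sub>E {..<t}. \<Prod>i\<in>?I. (fps_X ^ i) ^ c i)"
    unfolding regular_distinct_fps_def by (rule prod_sum_PiE) simp_all
  also have "\<dots> = (\<Sum>c\<in>?I \<rightarrow>\<^sub>E {..<t}. fps_X ^ (\<Sum>i\<in>?I. i * c i))"
    by (simp add: power_sum power_mult)
  finally have "regular_distinct_fps s t N $ n =
      (\<Sum>c\<in>?I \<rightarrow>\<^sub>E {..<t}. if (\<Sum>i\<in>?I. i * c i) = n then 1 else 0)"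
    by (simp add: fps_sum_nth eq_commute)
  also have "\<dots> = of_nat (card {c \<in> ?I \<rightarrow>\<^sub>E {..<t}. (\<Sum>i\<in>?I. i * c i) = n})"
    by (simp add: sum.If_cases finite_PiE Int_def)
  finally show ?thesis
    using bij_betw_same_card[OF bij_betw_multiplicities[OF assms]] by simp
qed

text \<open>The truncation of P(k) to its first \<open>N\<close> factors.\<close>

definition euler_prod :: "nat \<Rightarrow> nat \<Rightarrow> rat fps" where
  "euler_prod k N = (\<Prod>i=1..N. 1 - fps_X ^ (k * i))"

lemma euler_prod_nth_0:
  assumes "0 < k"
  shows "euler_prod k N $ 0 = 1"
  using assms by (induction N) (simp_all add: euler_prod_def)

text \<open>Each factor with \<open>i > n\<close> is 1 modulo X^(n+1), since its exponent
  \<open>k * i\<close> exceeds \<open>n\<close>.\<close>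

lemma euler_prod_mod:
  assumes "0 < k" and "n \<le> N"
  shows "euler_prod k N mod fps_X ^ Suc n = euler_prod k n mod fps_X ^ Suc n"
  using \<open>n \<le> N\<close>
proof (induction N rule: dec_induct)
  case (step N)
  have "Suc n \<le> k * Suc N" using step.hyps \<open>0 < k\<close> by (cases k) auto
  then have "fps_X ^ Suc n dvd euler_prod k N * fps_X ^ (k * Suc N)"
    by (intro dvd_mult le_imp_power_dvd)
  moreover have "euler_prod k N - euler_prod k (Suc N) = euler_prod k N * fps_X ^ (k * Suc N)"
    by (simp add: euler_prod_def algebra_simps)
  ultimately show ?case
    using step.IH by (metis mod_eq_dvd_iff)
qed simp

text \<open>The indices divisible by \<open>s\<close> are \<open>s * j\<close> with
  \<open>j \<le> M\<close>, and their factors form the second product. Truncating at a multiple of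
  \<open>s\<close> makes this exact.\<close>

lemma euler_prod_split:
  assumes "0 < s"
  shows "euler_prod k (s * M) =
    (\<Prod>i\<in>nonmultiples s (s * M). 1 - fps_X ^ (k * i)) * euler_prod (k * s) M"
proof -
  have union: "{1..s * M} = nonmultiples s (s * M) \<union> (*) s ` {1..M}"
    using assms by (auto simp: nonmultiples_def Suc_le_eq elim!: dvdE)
  have "(\<Prod>i\<in>(*) s ` {1..M}. 1 - fps_X ^ (k * i)) = euler_prod (k * s) M"
    unfolding euler_prod_def using assms
    by (subst prod.reindex) (auto simp: inj_on_def mult.assoc)
  then show ?thesis
    unfolding euler_prod_def[of k] union
    by (subst prod.union_disjoint) (auto simp: nonmultiples_def)
qed

text \<open>This is the quotient formula for the generating function with denominators cleared. The
  truncation levels are matched so that it holds exactly, not just modulo a power of X.\<close>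

lemma regular_distinct_fps_mult_euler_prod:
  assumes "0 < s"
  shows "regular_distinct_fps s t (s * M) * (euler_prod 1 (s * M) * euler_prod (s * t) M) =
    euler_prod t (s * M) * euler_prod s M"
proof -
  let ?A = "\<lambda>k. \<Prod>i\<in>nonmultiples s (s * M). 1 - fps_X ^ (k * i) :: rat fps"
  have "1 - fps_X ^ (t * i) = (\<Sum>j<t. (fps_X ^ i) ^ j) * (1 - fps_X ^ i :: rat fps)" for i
    using one_diff_power_eq[of "fps_X ^ i :: rat fps" t]
    by (simp add: power_mult[symmetric] mult.commute)
  then have F: "regular_distinct_fps s t (s * M) * ?A 1 = ?A t"
    by (simp add: regular_distinct_fps_def prod.distrib)
  \<comment> \<open>Splitting at \<open>k = 1\<close> exposes \<open>?A 1\<close>, which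
    \<open>F\<close> turns into \<open>?A t\<close>; splitting at \<open>k = t\<close>, read
    backwards, then absorbs \<open>euler_prod (s * t) M\<close>.\<close>
  have "regular_distinct_fps s t (s * M) * (euler_prod 1 (s * M) * euler_prod (s * t) M) =
      (regular_distinct_fps s t (s * M) * ?A 1) * (euler_prod s M * euler_prod (s * t) M)"
    unfolding euler_prod_split[OF assms, of 1] mult_1 by (simp only: mult.assoc)
  also have "\<dots> = euler_prod t (s * M) * euler_prod s M"
    unfolding F euler_prod_split[OF assms, of t] mult.commute[of t s] by (simp only: ac_simps)
  finally show ?thesis .
qed

text \<open>Modulo X^(n+1) all Euler products may be cut at the common level \<open>n\<close>, which
  makes both the cofactor and the right-hand side symmetric in \<open>s\<close> and
  \<open>t\<close>.\<close>

lemma regular_distinct_fps_mod: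
  assumes "0 < s" and "0 < t" and "n \<le> M"
  shows "regular_distinct_fps s t (s * M) * (euler_prod 1 n * euler_prod (s * t) n)
      mod fps_X ^ Suc n = euler_prod t n * euler_prod s n mod fps_X ^ Suc n"
proof -
  have "n \<le> s * M" using assms by (cases s) auto
  note mod_simps = euler_prod_mod[OF _ this] euler_prod_mod[OF _ \<open>n \<le> M\<close>]
  have "regular_distinct_fps s t (s * M) * (euler_prod 1 n * euler_prod (s * t) n)
      mod fps_X ^ Suc n = regular_distinct_fps s t (s * M) *
      (euler_prod 1 (s * M) * euler_prod (s * t) M) mod fps_X ^ Suc n"
    using assms
    by (intro mod_mult_cong refl) (simp_all only: mod_simps nat_0_less_mult_iff zero_less_one)
  also have "\<dots> = euler_prod t (s * M) * euler_prod s M mod fps_X ^ Suc n"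
    using assms by (simp only: regular_distinct_fps_mult_euler_prod)
  also have "\<dots> = euler_prod t n * euler_prod s n mod fps_X ^ Suc n"
    using assms by (intro mod_mult_cong) (simp_all only: mod_simps)
  finally show ?thesis .
qed

theorem theorem3:
  fixes s t n :: nat
  assumes "0 < s" and "0 < t"
  shows "card {ps \<in> partitions n. regular s ps \<and> distinct_parts t ps} =
         card {ps \<in> partitions n. regular t ps \<and> distinct_parts s ps}"
proof -
  \<comment> \<open>The levels have the required form \<open>s * M\<close> and \<open>t * M\<close>,
    with \<open>M = t * n\<close> and \<open>M = s * n\<close>, both at least
    \<open>n\<close>.\<close>
  let ?F = "regular_distinct_fps s t (s * (t * n))"
  let ?G = "regular_distinct_fps t s (t * (s * n))"
  let ?D = "euler_prod 1 n * euler_prod (s * t) n"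
  have le: "n \<le> t * n" "n \<le> s * n" "n \<le> s * (t * n)" "n \<le> t * (s * n)"
    using assms by (simp_all add: Suc_le_eq)
  have "?F * ?D mod fps_X ^ Suc n = ?G * ?D mod fps_X ^ Suc n"
    using regular_distinct_fps_mod[OF assms le(1)]
      regular_distinct_fps_mod[OF assms(2) assms(1) le(2)] by (simp only: mult.commute)
  then have "fps_X ^ Suc n dvd (?F - ?G) * ?D"
    unfolding mod_eq_dvd_iff left_diff_distrib .
  \<comment> \<open>The constant term of \<open>?D\<close> is 1, so \<open>?D\<close> is invertible
    and can be cancelled.\<close>
  moreover have "is_unit ?D"
    using assms by (simp add: euler_prod_nth_0)
  ultimately have "fps_X ^ Suc n dvd ?F - ?G"
    using dvd_mult_unit_iff by blast
  then obtain h where "?F - ?G = fps_X ^ Suc n * h" ..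
  then have "(?F - ?G) $ n = 0"
    by (simp only: fps_X_power_mult_nth) simp
  then show ?thesis
    using assms le by (simp add: regular_distinct_fps_nth)
qed

end
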